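(* Let $\sigma$ be a nonempty compact subset of $\mathbb{C}$ and let $f:\sigma\to\mathbb{C}$. Then $f\in AC(\sigma)$ if and only if for every point $x\in\sigma$ there exists a compact neighbourhood $U_x$ of $x$ in $\sigma$ such that $f|U_x\in AC(U_x)$.
   Context: Identify $\mathbb{C}$ with $\mathbb{R}^2$. A list $S=[x_0,x_1,\dots,x_n]$ ($n\ge 0$) is a finite ordered list of points of the plane; repetitions are allowed. For a line $\ell$ in the plane and $n\ge 1$, the segment $\overline{x_j\,x_{j+1}}$ ($0\le j<n$) is a crossing segment of $S$ on $\ell$ if one of the following holds: (1) $x_j$ and $x_{j+1}$ lie on strictly opposite sides of $\ell$; (2) $j=0$ and $x_0\in\ell$; (3) $x_j\notin\ell$ and $x_{j+1}\in\ell$. Let $\mathrm{vf}(S,\ell)$ be the number of crossing segments of $S$ on $\ell$ (counted by index $j$); for $n=0$ put $\mathrm{vf}([x_0],\ell)=1$ if $x_0\in\ell$ and $0$ otherwise. The variation factor is $\mathrm{vf}(S)=\max_\ell \mathrm{vf}(S,\ell)$, the maximum over all lines in the plane. For a nonempty compact set $\sigma$ in the plane, $f:\sigma\to\mathbb{C}$ and a list $S=[x_0,\dots,x_n]$ of elements of $\sigma$, put $\mathrm{cvar}(f,S)=\sum_{i=1}^n|f(x_i)-f(x_{i-1})|$ (equal to $0$ if $n=0$), and $\mathrm{var}(f,\sigma)=\sup_S \mathrm{cvar}(f,S)/\mathrm{vf}(S)\in[0,\infty]$, the supremum over all finite ordered lists of elements of $\sigma$. Put $\|f\|_{BV(\sigma)}=\|f\|_\infty+\mathrm{var}(f,\sigma)$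 with $\|f\|_\infty=\sup_{z\in\sigma}|f(z)|$, and $BV(\sigma)=\{f:\sigma\to\mathbb{C} : \|f\|_{BV(\sigma)}<\infty\}$. Let $\mathcal{P}_2$ be the algebra of functions on $\sigma$ of the form $p(x,y)=\sum_{m,n=0}^N c_{mn}x^my^n$ with $c_{mn}\in\mathbb{C}$ (complex polynomials in the two real coordinates); these all lie in $BV(\sigma)$. $AC(\sigma)$ is the closure of $\mathcal{P}_2$ in $(BV(\sigma),\|\cdot\|_{BV(\sigma)})$. A set $U$ is a compact neighbourhood of a point $x\in\sigma$ (with respect to $\sigma$) if there is an open set $V\subseteq\mathbb{C}$ containing $x$ such that $U=\sigma\cap\overline{V}$. *)

theory Defs
  imports "HOL-Analysis.Analysis"
begin

definition plane_line :: "complex set \<Rightarrow> bool" where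
  "plane_line l \<longleftrightarrow> (\<exists>a b. a \<noteq> 0 \<and> l = {z. a \<bullet> z = b})"

text \<open>
  The two sides of a line are its complementary open half-planes.  The relation is symmetric,
  since \<open>(a, b)\<close> may be replaced by \<open>(- a, - b)\<close>.
\<close>

definition opposite_sides :: "complex set \<Rightarrow> complex \<Rightarrow> complex \<Rightarrow> bool" where
  "opposite_sides l x y \<longleftrightarrow> (\<exists>a b. a \<noteq> 0 \<and> l = {z. a \<bullet> z = b} \<and> a \<bullet> x < b \<and> b < a \<bullet> y)"

definition crossing_segment :: "complex list \<Rightarrow> complex set \<Rightarrow> nat \<Rightarrow> bool" where
  "crossing_segment S l j \<longleftrightarrow> Suc j < length S \<and>
     (opposite_sides l (S ! j) (S ! Suc j)
      \<or> j = 0 \<and> S ! 0 \<in> l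
      \<or> S ! j \<notin> l \<and> S ! Suc j \<in> l)"

text \<open>
  The list \<open>[x\<^sub>0, \<dots>, x\<^sub>n]\<close> has length \<open>n + 1\<close>; the empty list is not among the lists considered
  and is excluded in \<open>var_on\<close> below.
\<close>

definition vf_line :: "complex list \<Rightarrow> complex set \<Rightarrow> nat" where
  "vf_line S l = (if length S = 1 then (if S ! 0 \<in> l then 1 else 0)
                  else card {j. crossing_segment S l j})"

definition vf :: "complex list \<Rightarrow> nat" where
  "vf S = Max {vf_line S l | l. plane_line l}"

text \<open>The maximum defining \<open>vf\<close> is attained, and is positive for nonempty lists.\<close>

lemma crossing_segment_subset: "{j. crossing_segment S l j} \<subseteq> {..<length S}"
  by (auto simp: crossing_segment_def)

lemma vf_line_le: "vf_line S l \<le> length S"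
  using card_mono[OF _ crossing_segment_subset, of S l] by (auto simp: vf_line_def)

lemma finite_vf_line_values: "finite {vf_line S l | l. plane_line l}"
  by (rule finite_subset[of _ "{..length S}"]) (auto simp: vf_line_le)

lemma vf_line_le_vf: "plane_line l \<Longrightarrow> vf_line S l \<le> vf S"
  unfolding vf_def by (rule Max_ge[OF finite_vf_line_values]) auto

lemma vf_attained: "\<exists>l. plane_line l \<and> vf_line S l = vf S"
proof -
  have "plane_line {z. (1::complex) \<bullet> z = 0}"
    unfolding plane_line_def using one_neq_zero by blast
  then have "{vf_line S l | l. plane_line l} \<noteq> {}" by blast
  from Max_in[OF finite_vf_line_values this] show ?thesis
    unfolding vf_def by auto
qed

lemma vf_pos:
  assumes "S \<noteq> []"
  shows "0 < vf S"
proof -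
  define l where "l = {z. (1::complex) \<bullet> z = 1 \<bullet> (S ! 0)}"
  have l: "plane_line l"
    unfolding l_def plane_line_def using one_neq_zero by blast
  have mem: "S ! 0 \<in> l" by (simp add: l_def)
  have "0 < vf_line S l"
  proof (cases "length S = 1")
    case True
    then show ?thesis using mem by (simp add: vf_line_def)
  next
    case False
    then have "0 \<in> {j. crossing_segment S l j}"
      using mem assms by (cases S) (auto simp: crossing_segment_def)
    then have "0 < card {j. crossing_segment S l j}"
      using finite_subset[OF crossing_segment_subset] by (metis card_gt_0_iff empty_iff finite_lessThan)
    then show ?thesis using False by (simp add: vf_line_def)
  qed
  with vf_line_le_vf[OF l] show ?thesis by (meson less_le_trans)
qed

definition cvar :: "(complex \<Rightarrow> complex) \<Rightarrow> complex list \<Rightarrow> real" where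
  "cvar f S = (\<Sum>i = 1..<length S. cmod (f (S ! i) - f (S ! (i - 1))))"

text \<open>
  A function \<open>\<sigma> \<rightarrow> \<complex>\<close> is represented by a total function of which only the values on \<open>\<sigma>\<close> matter;
  its restriction to \<open>U \<subseteq> \<sigma>\<close> is then the same total function, considered on \<open>U\<close>.
  See \<open>BV_cong\<close> and \<open>AC_cong\<close>.
\<close>

definition var_on :: "complex set \<Rightarrow> (complex \<Rightarrow> complex) \<Rightarrow> ennreal" where
  "var_on \<sigma> f = (SUP S\<in>{S. S \<noteq> [] \<and> set S \<subseteq> \<sigma>}. ennreal (cvar f S / real (vf S)))"

definition sup_norm_on :: "complex set \<Rightarrow> (complex \<Rightarrow> complex) \<Rightarrow> ennreal" where
  "sup_norm_on \<sigma> f = (SUP z\<in>\<sigma>. ennreal (cmod (f z)))"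

definition BV_norm :: "complex set \<Rightarrow> (complex \<Rightarrow> complex) \<Rightarrow> ennreal" where
  "BV_norm \<sigma> f = sup_norm_on \<sigma> f + var_on \<sigma> f"

definition BV :: "complex set \<Rightarrow> (complex \<Rightarrow> complex) set" where
  "BV \<sigma> = {f. BV_norm \<sigma> f < \<infinity>}"

definition P2 :: "(complex \<Rightarrow> complex) set" where
  "P2 = {p. \<exists>(N::nat) (c :: nat \<Rightarrow> nat \<Rightarrow> complex).
     p = (\<lambda>z. \<Sum>m\<le>N. \<Sum>n\<le>N. c m n * of_real (Re z) ^ m * of_real (Im z) ^ n)}"

definition AC :: "complex set \<Rightarrow> (complex \<Rightarrow> complex) set" where
  "AC \<sigma> = {f \<in> BV \<sigma>. \<forall>\<epsilon>>0. \<exists>p\<in>P2. BV_norm \<sigma> (\<lambda>z. f z - p z) < \<epsilon>}"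

definition compact_neighbourhood :: "complex set \<Rightarrow> complex \<Rightarrow> complex set \<Rightarrow> bool" where
  "compact_neighbourhood \<sigma> x U \<longleftrightarrow> (\<exists>V. open V \<and> x \<in> V \<and> U = \<sigma> \<inter> closure V)"

lemma cvar_cong:
  assumes "set S \<subseteq> \<sigma>" and "\<And>z. z \<in> \<sigma> \<Longrightarrow> f z = g z"
  shows "cvar f S = cvar g S"
proof -
  have "f (S ! i) = g (S ! i)" if "i < length S" for i
    using assms that by (meson nth_mem subsetD)
  then show ?thesis
    unfolding cvar_def by (intro sum.cong) auto
qed

lemma BV_norm_cong:
  assumes "\<And>z. z \<in> \<sigma> \<Longrightarrow> f z = g z"
  shows "BV_norm \<sigma> f = BV_norm \<sigma> g"
proof -
  have "cvar f S = cvar g S" if "set S \<subseteq> \<sigma>" for S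
    using cvar_cong[OF that] assms by blast
  then have "var_on \<sigma> f = var_on \<sigma> g"
    unfolding var_on_def by (intro SUP_cong) auto
  moreover have "sup_norm_on \<sigma> f = sup_norm_on \<sigma> g"
    unfolding sup_norm_on_def using assms by (intro SUP_cong) auto
  ultimately show ?thesis by (simp add: BV_norm_def)
qed

lemma BV_cong:
  assumes "\<And>z. z \<in> \<sigma> \<Longrightarrow> f z = g z"
  shows "f \<in> BV \<sigma> \<longleftrightarrow> g \<in> BV \<sigma>"
  using BV_norm_cong[of \<sigma> f g, OF assms] by (simp add: BV_def)

lemma AC_cong:
  assumes "\<And>z. z \<in> \<sigma> \<Longrightarrow> f z = g z"
  shows "f \<in> AC \<sigma> \<longleftrightarrow> g \<in> AC \<sigma>"
proof -
  have "BV_norm \<sigma> (\<lambda>z. f z - p z) = BV_norm \<sigma> (\<lambda>z. g z - p z)" for p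
    by (rule BV_norm_cong) (simp add: assms)
  then show ?thesis
    using BV_cong[of \<sigma> f g, OF assms] by (simp add: AC_def)
qed

end

theory Submission
  imports Defs
begin

text \<open>
  For the nontrivial direction, \<open>f\<close> is patched together by a partition of unity
  \<open>\<psi>\<^sub>i \<Prod>\<^sub>j\<^sub><\<^sub>i (1 - \<psi>\<^sub>j)\<close>, where each \<open>\<psi>\<^sub>i\<close> is a cutoff function supported in a small square on
  which \<open>f\<close> is absolutely continuous.  Since \<open>AC \<sigma>\<close> is a closed algebra containing all \<open>C\<^sup>1\<close> functions
  of one linear coordinate, it contains the \<open>\<psi>\<^sub>i\<close>, and it suffices that \<open>f \<psi>\<^sub>i\<close>, extended by zero,
  lies in \<open>AC \<sigma>\<close>.  If \<open>g\<close> vanishes outside the open square, then \<open>BV\<close> bounds for \<open>g\<close> on the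
  closed square carry over to \<open>\<sigma>\<close> up to a constant: deleting the points of a list outside
  the square does not increase its variation factor, and every segment that joins the support to
  the outside crosses one of the four lines bounding the square.
\<close>

section \<open>Sums over consecutive pairs of a list\<close>

text \<open>Both \<open>cvar\<close> and the crossing counts are sums over consecutive pairs; the
  recursive form permits induction on lists. The value type is general since counts live in
  \<open>nat\<close> and lengths in \<open>real\<close>.\<close>

fun path_sum :: "('a \<Rightarrow> 'a \<Rightarrow> 'b::comm_monoid_add) \<Rightarrow> 'a list \<Rightarrow> 'b" where
  "path_sum d (x # y # xs) = d x y + path_sum d (y # xs)"
| "path_sum d _ = 0"

lemma path_sum_eq_sum: "path_sum d S = (\<Sum>i<length S - 1. d (S ! i) (S ! Suc i))"
proof (induction d S rule: path_sum.induct)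
  case (1 d x y xs)
  then show ?case
    by (simp del: sum.lessThan_Suc add: sum.lessThan_Suc_shift)
qed auto

lemma path_sum_mono:
  fixes d e :: "'a \<Rightarrow> 'a \<Rightarrow> 'b::ordered_comm_monoid_add"
  assumes "\<And>x y. x \<in> set S \<Longrightarrow> y \<in> set S \<Longrightarrow> d x y \<le> e x y"
  shows "path_sum d S \<le> path_sum e S"
  using assms by (induction d S rule: path_sum.induct) (auto intro!: add_mono)

lemma path_sum_add: "path_sum (\<lambda>x y. d x y + e x y) S = path_sum d S + path_sum e S"
  by (induction d S rule: path_sum.induct) (auto simp: ac_simps)

lemma path_sum_cmult:
  fixes c :: "'b::semiring_0"
  shows "path_sum (\<lambda>x y. c * d x y) S = c * path_sum d S"
  by (induction d S rule: path_sum.induct) (auto simp: algebra_simps)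

lemma path_sum_Cons_ge:
  fixes d :: "'a \<Rightarrow> 'a \<Rightarrow> real"
  assumes "\<And>x y. 0 \<le> d x y"
  shows "path_sum d S \<le> path_sum d (x # S)"
  using assms by (cases S) auto

lemma path_sum_Cons_triangle:
  fixes d :: "'a \<Rightarrow> 'a \<Rightarrow> nat"
  assumes "\<And>x y z. d x z \<le> d x y + d y z"
  shows "path_sum d (x # S) \<le> d x y + path_sum d (y # S)"
  using assms[of x _ y] by (cases S) (auto simp flip: add.assoc)

text \<open>By the triangle inequality an intermediate point can be skipped. The head
  \<open>x\<close> stays outside the filter, so that the induction can pass from it directly to the
  next surviving point.\<close>

lemma path_sum_filter_le:
  fixes d :: "'a \<Rightarrow> 'a \<Rightarrow> nat"
  assumes "\<And>x y z. d x z \<le> d x y + d y z"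
  shows "path_sum d (x # filter P S) \<le> path_sum d (x # S)"
proof (induction S arbitrary: x)
  case (Cons y S)
  show ?case
    using Cons[of y] path_sum_Cons_triangle[of d x "filter P S" y, OF assms] by auto
qed simp

lemma cvar_eq_path_sum: "cvar f S = path_sum (\<lambda>x y. cmod (f y - f x)) S"
proof -
  have "(\<Sum>i = 1..<length S. cmod (f (S ! i) - f (S ! (i - 1))))
      = (\<Sum>i<length S - 1. cmod (f (S ! Suc i) - f (S ! i)))"
    by (rule sum.reindex_bij_witness[of _ Suc "\<lambda>i. i - 1"]) auto
  then show ?thesis
    by (simp add: cvar_def path_sum_eq_sum)
qed

section \<open>Crossing counts and the variation factor\<close>

text \<open>These are the cases (1) and (3) of a crossing segment, which depend only on the two end
  points. The relation is directed: leaving \<open>l\<close> does not count.\<close>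

definition enters :: "complex set \<Rightarrow> complex \<Rightarrow> complex \<Rightarrow> bool" where
  "enters l x y \<longleftrightarrow> opposite_sides l x y \<or> x \<notin> l \<and> y \<in> l"

lemma opposite_sides_sym: "opposite_sides l x y \<longleftrightarrow> opposite_sides l y x"
proof -
  have "opposite_sides l y x" if "opposite_sides l x y" for x y
  proof -
    from that obtain a b where "a \<noteq> 0" "l = {z. a \<bullet> z = b}" "a \<bullet> x < b" "b < a \<bullet> y"
      by (auto simp: opposite_sides_def)
    then have "- a \<noteq> 0 \<and> l = {z. - a \<bullet> z = - b} \<and> - a \<bullet> y < - b \<and> - b < - a \<bullet> x"
      by auto
    then show ?thesis
      unfolding opposite_sides_def by blast
  qed
  then show ?thesis by blast
qed

lemma opposite_sides_notin: "opposite_sides l x y \<Longrightarrow> x \<notin> l"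
  by (auto simp: opposite_sides_def)

text \<open>The indicator of \<open>enters\<close> thus behaves like a directed distance, as
  deleting points requires. Wherever \<open>y\<close> lies relative to \<open>l\<close>, one of the
  two steps already performs the crossing.\<close>

lemma enters_triangle:
  "(of_bool (enters l x z) :: nat) \<le> of_bool (enters l x y) + of_bool (enters l y z)"
proof -
  have "enters l x y \<or> enters l y z" if "opposite_sides l x z"
  proof -
    from that obtain a b where ab: "a \<noteq> 0" "l = {z. a \<bullet> z = b}" "a \<bullet> x < b" "b < a \<bullet> z"
      by (auto simp: opposite_sides_def)
    consider "a \<bullet> y < b" | "a \<bullet> y = b" | "b < a \<bullet> y" by linarith
    then show ?thesis
    proof cases
      case 1
      with ab have "opposite_sides l y z" unfolding opposite_sides_def by blast
      then show ?thesis by (simp add: enters_def)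
    next
      case 2
      with ab have "y \<in> l" "x \<notin> l" by auto
      then show ?thesis by (simp add: enters_def)
    next
      case 3
      with ab have "opposite_sides l x y" unfolding opposite_sides_def by blast
      then show ?thesis by (simp add: enters_def)
    qed
  qed
  then show ?thesis by (auto simp: enters_def)
qed

text \<open>A segment that starts on \<open>l\<close> never enters \<open>l\<close>, so the initial
  term and the path sum count disjoint sets of indices. The separate convention for one-point lists
  fits the same formula.\<close>

lemma vf_line_eq_path_sum:
  assumes "S \<noteq> []"
  shows "vf_line S l = of_bool (hd S \<in> l) + path_sum (\<lambda>x y. of_bool (enters l x y)) S"
proof (cases "length S = 1")
  case True
  then obtain x where "S = [x]" by (cases S) auto
  then show ?thesis by (simp add: vf_line_def)
next
  case False
  define A where "A = {j. j < length S - 1 \<and> enters l (S ! j) (S ! Suc j)}"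
  have len: "Suc 0 < length S" using False assms by (cases S) auto
  have hd: "hd S = S ! 0" using assms by (simp add: hd_conv_nth)
  have "{j. crossing_segment S l j} = (if hd S \<in> l then {0} else {}) \<union> A"
    using len by (auto simp: crossing_segment_def A_def enters_def hd)
  moreover have "(if hd S \<in> l then {0} else {}) \<inter> A = {}"
    by (auto simp: A_def enters_def hd dest: opposite_sides_notin)
  moreover have "finite A" by (simp add: A_def)
  ultimately have "card {j. crossing_segment S l j} = of_bool (hd S \<in> l) + card A"
    by (auto simp: card_Un_disjoint)
  moreover have "card A = (\<Sum>i<length S - 1. of_bool (enters l (S ! i) (S ! Suc i)))"
  proof -
    have "A = {..<length S - 1} \<inter> {j. enters l (S ! j) (S ! Suc j)}" by (auto simp: A_def)
    then show ?thesis by simp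
  qed
  ultimately show ?thesis
    using False by (simp add: vf_line_def path_sum_eq_sum)
qed

lemma vf_line_filter_le:
  assumes "filter P S \<noteq> []"
  shows "vf_line (filter P S) l \<le> vf_line S l"
  using assms
proof (induction S)
  case (Cons x S)
  let ?d = "\<lambda>x y. of_bool (enters l x y) :: nat"
  show ?case
  proof (cases "P x")
    case True
    then show ?thesis
      using path_sum_filter_le[of ?d x P S, OF enters_triangle] by (simp add: vf_line_eq_path_sum)
  next
    case False
    with Cons.prems obtain y S' where S: "S = y # S'" by (cases S) auto
    \<comment> \<open>Without \<open>x\<close>, the point \<open>y\<close> becomes the head and may
      gain an initial crossing. If \<open>y\<close> lies on \<open>l\<close>, then the longer list
      already counts either its head \<open>x\<close> on \<open>l\<close> or the step from
      \<open>x\<close> to \<open>y\<close>.\<close>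
    have "vf_line S l \<le> vf_line (x # S) l"
      by (auto simp: vf_line_eq_path_sum S enters_def)
    then show ?thesis using Cons False by simp
  qed
qed simp

lemma vf_filter_le:
  assumes "filter P S \<noteq> []"
  shows "vf (filter P S) \<le> vf S"
proof -
  obtain l where "plane_line l" "vf_line (filter P S) l = vf (filter P S)"
    using vf_attained by blast
  then show ?thesis
    using vf_line_filter_le[OF assms, of l] vf_line_le_vf[of l S] by linarith
qed

text \<open>Strict crossings are among the segments counted by \<open>vf_line\<close>. Counting them
  alone gives a lower bound for \<open>vf\<close> whose summands are symmetric in the end
  points.\<close>

lemma opposite_sides_path_sum_le_vf:
  assumes "plane_line l"
  shows "path_sum (\<lambda>x y. of_bool (opposite_sides l x y)) S \<le> real (vf S)"
proof (cases "S = []")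
  case False
  have "path_sum (\<lambda>x y. of_bool (opposite_sides l x y)) S
      \<le> path_sum (\<lambda>x y. of_bool (enters l x y) :: nat) S"
    by (rule path_sum_mono) (auto simp: enters_def)
  also have "\<dots> \<le> vf_line S l"
    using False by (simp add: vf_line_eq_path_sum)
  also have "\<dots> \<le> vf S"
    by (rule vf_line_le_vf[OF assms])
  finally have "real (path_sum (\<lambda>x y. of_bool (opposite_sides l x y)) S) \<le> real (vf S)"
    by simp
  then show ?thesis
    by (simp add: path_sum_eq_sum)
qed simp

lemma plane_lineI: "w \<noteq> 0 \<Longrightarrow> plane_line {z. w \<bullet> z = c}"
  unfolding plane_line_def by blast

lemma opposite_sidesI:
  assumes "w \<noteq> 0" "w \<bullet> x < c" "c < w \<bullet> y"
  shows "opposite_sides {z. w \<bullet> z = c} x y"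
  using assms unfolding opposite_sides_def by blast

text \<open>
  The length of the projection of a polygonal path is the integral over \<open>c\<close> of the number of
  times the path crosses the line \<open>w \<bullet> z = c\<close>, and each of these numbers is at most \<open>vf S\<close>.
\<close>

lemma inner_path_sum_le:
  assumes "a \<le> b" and "\<And>z. z \<in> set S \<Longrightarrow> w \<bullet> z \<in> {a..b}"
  shows "path_sum (\<lambda>x y. \<bar>w \<bullet> y - w \<bullet> x\<bar>) S \<le> (b - a) * real (vf S)"
proof (cases "w = 0")
  case True
  then show ?thesis using assms(1) by (simp add: path_sum_eq_sum)
next
  case False
  \<comment> \<open>With strict inequalities \<open>I c x y\<close> is at most the indicator of
    strictly opposite sides; the two end values of \<open>c\<close> are negligible in the
    integral.\<close>
  define I where "I = (\<lambda>c x y. if min (w \<bullet> x) (w \<bullet> y) < c \<and> c < max (w \<bullet> x) (w \<bullet> y) then 1 else (0::real))"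
  have I: "((\<lambda>c. I c x y) has_integral \<bar>w \<bullet> y - w \<bullet> x\<bar>) {a..b}"
    if "x \<in> set S" "y \<in> set S" for x y
  proof -
    let ?s = "min (w \<bullet> x) (w \<bullet> y)" and ?t = "max (w \<bullet> x) (w \<bullet> y)"
    have sub: "{?s<..<?t} \<subseteq> {a..b}" using assms(2)[OF that(1)] assms(2)[OF that(2)] by auto
    have "((\<lambda>c. 1::real) has_integral ?t - ?s) {?s..?t}"
      using has_integral_const_real[of "1::real" ?s ?t] by (simp split: if_splits)
    then have "((\<lambda>c. 1::real) has_integral ?t - ?s) {?s<..<?t}"
      by (simp add: has_integral_Icc_iff_Ioo)
    then have "((\<lambda>c. if c \<in> {?s<..<?t} then 1::real else 0) has_integral ?t - ?s) {a..b}"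
      by (rule iffD2[OF has_integral_restrict[OF sub]])
    moreover have "?t - ?s = \<bar>w \<bullet> y - w \<bullet> x\<bar>" by (simp add: max_def min_def)
    ultimately show ?thesis by (simp add: I_def)
  qed
  have "((\<lambda>c. path_sum (I c) S) has_integral path_sum (\<lambda>x y. \<bar>w \<bullet> y - w \<bullet> x\<bar>) S) {a..b}"
    unfolding path_sum_eq_sum using I by (intro has_integral_sum) auto
  moreover have "((\<lambda>c. real (vf S)) has_integral (b - a) * real (vf S)) {a..b}"
    using has_integral_const_real[of "real (vf S)" a b] assms(1) by simp
  moreover have "path_sum (I c) S \<le> real (vf S)" for c
  proof -
    have "path_sum (I c) S \<le> path_sum (\<lambda>x y. of_bool (opposite_sides {z. w \<bullet> z = c} x y)) S"
    proof (rule path_sum_mono)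
      fix x y
      show "I c x y \<le> of_bool (opposite_sides {z. w \<bullet> z = c} x y)"
        using opposite_sidesI[OF False, of x c y] opposite_sidesI[OF False, of y c x]
          opposite_sides_sym[of "{z. w \<bullet> z = c}" x y]
        by (auto simp: I_def min_def max_def split: if_splits)
    qed
    also have "\<dots> \<le> real (vf S)"
      by (rule opposite_sides_path_sum_le_vf[OF plane_lineI[OF False]])
    finally show ?thesis .
  qed
  ultimately show ?thesis
    by (rule has_integral_le)
qed

section \<open>Real bounds in place of the extended norm\<close>

text \<open>One real constant bounds the supremum and the variation separately, without division.
  The least such constant matches \<open>BV_norm\<close> up to a factor 2, which is harmless for
  membership in \<open>BV\<close> and for approximation.\<close>

definition bv_bound :: "complex set \<Rightarrow> (complex \<Rightarrow> complex) \<Rightarrow> real \<Rightarrow> bool" where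
  "bv_bound \<sigma> f e \<longleftrightarrow> 0 \<le> e \<and> (\<forall>z\<in>\<sigma>. cmod (f z) \<le> e)
     \<and> (\<forall>S. set S \<subseteq> \<sigma> \<longrightarrow> cvar f S \<le> e * real (vf S))"

lemma bv_bound_nonneg: "bv_bound \<sigma> f e \<Longrightarrow> 0 \<le> e"
  by (simp add: bv_bound_def)

lemma bv_bound_norm: "bv_bound \<sigma> f e \<Longrightarrow> z \<in> \<sigma> \<Longrightarrow> cmod (f z) \<le> e"
  by (simp add: bv_bound_def)

lemma bv_bound_cvar: "bv_bound \<sigma> f e \<Longrightarrow> set S \<subseteq> \<sigma> \<Longrightarrow> cvar f S \<le> e * real (vf S)"
  by (simp add: bv_bound_def)

lemma bv_bound_mono:
  assumes "bv_bound \<sigma> f e" "e \<le> e'" "\<tau> \<subseteq> \<sigma>"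
  shows "bv_bound \<tau> f e'"
proof -
  have "cvar f S \<le> e' * real (vf S)" if "set S \<subseteq> \<tau>" for S
    using bv_bound_cvar[OF assms(1), of S] that assms mult_right_mono[OF assms(2), of "real (vf S)"]
    by force
  then show ?thesis using assms by (force simp: bv_bound_def)
qed

lemma BV_norm_le_bv_bound:
  assumes "bv_bound \<sigma> f e"
  shows "BV_norm \<sigma> f \<le> ennreal (2 * e)"
proof -
  note e = bv_bound_nonneg[OF assms]
  have "sup_norm_on \<sigma> f \<le> ennreal e"
    unfolding sup_norm_on_def using bv_bound_norm[OF assms] by (intro SUP_least ennreal_leI)
  moreover have "var_on \<sigma> f \<le> ennreal e"
    unfolding var_on_def
    using bv_bound_cvar[OF assms] vf_pos
    by (intro SUP_least ennreal_leI) (auto simp: divide_le_eq)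
  ultimately have "BV_norm \<sigma> f \<le> ennreal e + ennreal e"
    unfolding BV_norm_def by (rule add_mono)
  then show ?thesis using e by (simp flip: ennreal_plus)
qed

lemma bv_bound_of_BV_norm:
  assumes "BV_norm \<sigma> f \<le> ennreal e" "0 \<le> e"
  shows "bv_bound \<sigma> f e"
proof -
  have "cmod (f z) \<le> e" if "z \<in> \<sigma>" for z
  proof -
    have "ennreal (cmod (f z)) \<le> sup_norm_on \<sigma> f"
      unfolding sup_norm_on_def using that by (rule SUP_upper)
    also have "\<dots> \<le> BV_norm \<sigma> f" by (simp add: BV_norm_def)
    finally have "ennreal (cmod (f z)) \<le> ennreal e" using assms(1) by (rule order_trans)
    then show ?thesis using assms(2) by simp
  qed
  moreover have "cvar f S \<le> e * real (vf S)" if "set S \<subseteq> \<sigma>" for S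
  proof (cases "S = []")
    case True
    then show ?thesis using assms(2) by (simp add: cvar_def)
  next
    case False
    have "ennreal (cvar f S / real (vf S)) \<le> var_on \<sigma> f"
      unfolding var_on_def using that False by (intro SUP_upper) simp
    also have "\<dots> \<le> BV_norm \<sigma> f" by (simp add: BV_norm_def)
    finally have "ennreal (cvar f S / real (vf S)) \<le> ennreal e" using assms(1) by (rule order_trans)
    then have "cvar f S / real (vf S) \<le> e" using assms(2) by simp
    then show ?thesis using vf_pos[OF False] by (simp add: divide_le_eq)
  qed
  ultimately show ?thesis using assms(2) by (simp add: bv_bound_def)
qed

lemma BV_iff_bv_bound: "f \<in> BV \<sigma> \<longleftrightarrow> (\<exists>e. bv_bound \<sigma> f e)"
proof
  assume "f \<in> BV \<sigma>"
  then have "BV_norm \<sigma> f = ennreal (enn2real (BV_norm \<sigma> f))" by (simp add: BV_def)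
  then show "\<exists>e. bv_bound \<sigma> f e"
    by (metis bv_bound_of_BV_norm enn2real_nonneg order_refl)
next
  assume "\<exists>e. bv_bound \<sigma> f e"
  then obtain e where "BV_norm \<sigma> f \<le> ennreal (2 * e)" using BV_norm_le_bv_bound by blast
  then show "f \<in> BV \<sigma>" by (auto simp: BV_def le_less_trans)
qed

lemma bv_bound_const: "bv_bound \<sigma> (\<lambda>z. c) (cmod c)"
  by (auto simp: bv_bound_def cvar_def)

lemma bv_bound_add:
  assumes "bv_bound \<sigma> f a" "bv_bound \<sigma> g b"
  shows "bv_bound \<sigma> (\<lambda>z. f z + g z) (a + b)"
proof -
  have "cvar (\<lambda>z. f z + g z) S \<le> (a + b) * real (vf S)" if "set S \<subseteq> \<sigma>" for S
  proof -
    have "cvar (\<lambda>z. f z + g z) S \<le> cvar f S + cvar g S"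
      unfolding cvar_eq_path_sum path_sum_add[symmetric]
      by (rule path_sum_mono) (metis add_diff_add norm_triangle_ineq)
    then show ?thesis
      using bv_bound_cvar[OF assms(1) that] bv_bound_cvar[OF assms(2) that]
      by (simp add: distrib_right)
  qed
  moreover have "cmod (f z + g z) \<le> a + b" if "z \<in> \<sigma>" for z
    using bv_bound_norm[OF assms(1) that] bv_bound_norm[OF assms(2) that] norm_triangle_ineq
    by (meson add_mono order_trans)
  ultimately show ?thesis
    using assms by (simp add: bv_bound_def)
qed

text \<open>Splitting the increment of a product as in the Leibniz rule gives two terms, each
  contributing at most \<open>a * b * vf S\<close>; hence the factor 2.\<close>

lemma bv_bound_mult:
  assumes "bv_bound \<sigma> f a" "bv_bound \<sigma> g b"
  shows "bv_bound \<sigma> (\<lambda>z. f z * g z) (2 * a * b)"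
proof -
  note ab = bv_bound_nonneg[OF assms(1)] bv_bound_nonneg[OF assms(2)]
  have "cvar (\<lambda>z. f z * g z) S \<le> 2 * a * b * real (vf S)" if S: "set S \<subseteq> \<sigma>" for S
  proof -
    have "cvar (\<lambda>z. f z * g z) S \<le> a * cvar g S + b * cvar f S"
      unfolding cvar_eq_path_sum path_sum_cmult[symmetric] path_sum_add[symmetric]
    proof (rule path_sum_mono)
      fix x y assume "x \<in> set S" "y \<in> set S"
      then have *: "cmod (f y) \<le> a" "cmod (g x) \<le> b"
        using S assms by (auto simp: bv_bound_def)
      have "f y * g y - f x * g x = f y * (g y - g x) + g x * (f y - f x)"
        by (simp add: algebra_simps)
      then have "cmod (f y * g y - f x * g x) \<le> cmod (f y) * cmod (g y - g x) + cmod (g x) * cmod (f y - f x)"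
        by (metis norm_mult norm_triangle_ineq)
      also have "\<dots> \<le> a * cmod (g y - g x) + b * cmod (f y - f x)"
        using * by (intro add_mono mult_right_mono) auto
      finally show "cmod (f y * g y - f x * g x) \<le> a * cmod (g y - g x) + b * cmod (f y - f x)" .
    qed
    also have "\<dots> \<le> a * (b * real (vf S)) + b * (a * real (vf S))"
      using ab bv_bound_cvar[OF assms(1) S] bv_bound_cvar[OF assms(2) S]
      by (intro add_mono mult_left_mono)
    finally show ?thesis by (simp add: algebra_simps)
  qed
  moreover have "cmod (f z * g z) \<le> 2 * a * b" if "z \<in> \<sigma>" for z
  proof -
    have "cmod (f z * g z) \<le> a * b"
      using bv_bound_norm[OF assms(1) that] bv_bound_norm[OF assms(2) that] ab
      by (simp add: norm_mult mult_mono)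
    then show ?thesis using mult_nonneg_nonneg[OF ab] by simp
  qed
  ultimately show ?thesis
    using ab by (simp add: bv_bound_def)
qed

text \<open>Increments are at most \<open>L\<close> times those of the linear coordinate, whose
  variation \<open>inner_path_sum_le\<close> bounds by the width \<open>b - a\<close>. The summand
  \<open>\<bar>h a\<bar>\<close> comes from bounding the supremum by comparison with the value at
  \<open>a\<close>.\<close>

lemma bv_bound_Lipschitz_inner:
  fixes h :: "real \<Rightarrow> real"
  assumes "a \<le> b" "\<And>z. z \<in> \<sigma> \<Longrightarrow> w \<bullet> z \<in> {a..b}"
    and "0 \<le> L" "\<And>s t. s \<in> {a..b} \<Longrightarrow> t \<in> {a..b} \<Longrightarrow> \<bar>h t - h s\<bar> \<le> L * \<bar>t - s\<bar>"
  shows "bv_bound \<sigma> (\<lambda>z. of_real (h (w \<bullet> z))) (\<bar>h a\<bar> + L * (b - a))"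
proof -
  have "cvar (\<lambda>z. of_real (h (w \<bullet> z))) S \<le> (\<bar>h a\<bar> + L * (b - a)) * real (vf S)"
    if S: "set S \<subseteq> \<sigma>" for S
  proof -
    have "cvar (\<lambda>z. of_real (h (w \<bullet> z))) S \<le> L * path_sum (\<lambda>x y. \<bar>w \<bullet> y - w \<bullet> x\<bar>) S"
      unfolding cvar_eq_path_sum path_sum_cmult[symmetric]
    proof (rule path_sum_mono)
      fix x y assume "x \<in> set S" "y \<in> set S"
      then have "\<bar>h (w \<bullet> y) - h (w \<bullet> x)\<bar> \<le> L * \<bar>w \<bullet> y - w \<bullet> x\<bar>"
        using S assms(2,4) by blast
      then show "cmod (of_real (h (w \<bullet> y)) - of_real (h (w \<bullet> x))) \<le> L * \<bar>w \<bullet> y - w \<bullet> x\<bar>"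
        by (simp flip: of_real_diff)
    qed
    also have "\<dots> \<le> L * ((b - a) * real (vf S))"
      using S assms by (intro mult_left_mono inner_path_sum_le) auto
    also have "\<dots> \<le> (\<bar>h a\<bar> + L * (b - a)) * real (vf S)"
      by (simp add: algebra_simps)
    finally show ?thesis .
  qed
  moreover have "\<bar>h (w \<bullet> z)\<bar> \<le> \<bar>h a\<bar> + L * (b - a)" if "z \<in> \<sigma>" for z
  proof -
    have z: "a \<le> w \<bullet> z" "w \<bullet> z \<le> b" using assms(2)[OF that] by auto
    then have "\<bar>h (w \<bullet> z) - h a\<bar> \<le> L * (w \<bullet> z - a)"
      using assms(1) assms(4)[of a "w \<bullet> z"] by auto
    also have "\<dots> \<le> L * (b - a)" using z assms(3) by (intro mult_left_mono) auto
    finally show ?thesis by linarith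
  qed
  ultimately show ?thesis
    using assms(1,3) by (simp add: bv_bound_def)
qed

lemma bounded_inner_interval:
  assumes "bounded (\<sigma> :: complex set)"
  obtains a b where "a \<le> b" "\<And>z. z \<in> \<sigma> \<Longrightarrow> w \<bullet> z \<in> {a..b}"
proof -
  obtain B where B: "\<And>z. z \<in> \<sigma> \<Longrightarrow> cmod z \<le> B" and "B > 0"
    using assms by (metis bounded_pos)
  have "\<bar>w \<bullet> z\<bar> \<le> cmod w * B" if "z \<in> \<sigma>" for z
    using Cauchy_Schwarz_ineq2[of w z] B[OF that] by (meson mult_left_mono norm_ge_zero order_trans)
  then show ?thesis
    using \<open>B > 0\<close> by (intro that[of "- (cmod w * B)" "cmod w * B"]) (auto simp: abs_le_iff minus_le_iff)
qed

section \<open>Algebra structure of \<open>BV\<close> and \<open>P2\<close>\<close>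

lemma BV_const: "(\<lambda>z. c) \<in> BV \<sigma>"
  using BV_iff_bv_bound bv_bound_const by blast

lemma BV_add: "f \<in> BV \<sigma> \<Longrightarrow> g \<in> BV \<sigma> \<Longrightarrow> (\<lambda>z. f z + g z) \<in> BV \<sigma>"
  unfolding BV_iff_bv_bound using bv_bound_add by blast

lemma BV_mult: "f \<in> BV \<sigma> \<Longrightarrow> g \<in> BV \<sigma> \<Longrightarrow> (\<lambda>z. f z * g z) \<in> BV \<sigma>"
  unfolding BV_iff_bv_bound using bv_bound_mult by blast

lemma BV_power: "f \<in> BV \<sigma> \<Longrightarrow> (\<lambda>z. f z ^ n) \<in> BV \<sigma>"
  by (induction n) (auto intro: BV_const BV_mult)

lemma BV_sum: "(\<And>i. i \<in> I \<Longrightarrow> f i \<in> BV \<sigma>) \<Longrightarrow> (\<lambda>z. \<Sum>i\<in>I. f i z) \<in> BV \<sigma>"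
  by (induction I rule: infinite_finite_induct) (auto intro: BV_const BV_add)

lemma BV_inner:
  assumes "bounded \<sigma>"
  shows "(\<lambda>z. of_real (w \<bullet> z)) \<in> BV \<sigma>"
proof -
  obtain a b where ab: "a \<le> b" "\<And>z. z \<in> \<sigma> \<Longrightarrow> w \<bullet> z \<in> {a..b}"
    using bounded_inner_interval[OF assms] by metis
  then have "bv_bound \<sigma> (\<lambda>z. of_real (w \<bullet> z)) (\<bar>a\<bar> + 1 * (b - a))"
    by (rule bv_bound_Lipschitz_inner) auto
  then show ?thesis using BV_iff_bv_bound by blast
qed

lemma P2_subset_BV:
  assumes "bounded \<sigma>"
  shows "P2 \<subseteq> BV \<sigma>"
proof
  fix p assume "p \<in> P2"
  then obtain N c where p: "p = (\<lambda>z. \<Sum>m\<le>N. \<Sum>n\<le>N. c m n * of_real (Re z) ^ m * of_real (Im z) ^ n)"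
    by (auto simp: P2_def)
  have "(\<lambda>z. of_real (Re z)) \<in> BV \<sigma>" "(\<lambda>z. of_real (Im z)) \<in> BV \<sigma>"
    using BV_inner[OF assms, of 1] BV_inner[OF assms, of \<i>] by (simp_all add: inner_complex_def)
  then show "p \<in> BV \<sigma>"
    unfolding p by (intro BV_sum BV_mult BV_power BV_const)
qed

text \<open>\<open>P2\<close> has one degree bound for both coordinates, so the monomial is placed
  in a square array of coefficients reaching up to \<open>max a b\<close>.\<close>

lemma P2_monom: "(\<lambda>z. c * of_real (Re z) ^ a * of_real (Im z) ^ b) \<in> P2"
proof -
  have "(\<Sum>m\<le>max a b. \<Sum>n\<le>max a b. (if m = a then if n = b then c else 0 else 0)
            * of_real (Re z) ^ m * of_real (Im z) ^ n)
      = c * of_real (Re z) ^ a * of_real (Im z) ^ b" for z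
  proof -
    have "(\<Sum>n\<le>max a b. (if m = a then if n = b then c else 0 else 0)
            * of_real (Re z) ^ m * of_real (Im z) ^ n)
       = (if m = a then c * of_real (Re z) ^ a * of_real (Im z) ^ b else 0)" for m
      by (simp add: if_distrib[where f = "\<lambda>x. x * _"] cong: if_cong)
    then show ?thesis by simp
  qed
  then show ?thesis
    unfolding P2_def mem_Collect_eq
    by (intro exI[of _ "max a b"] exI[of _ "\<lambda>m n. if m = a then if n = b then c else 0 else 0"]) metis
qed

lemma P2_const: "(\<lambda>z. c) \<in> P2"
  using P2_monom[of c 0 0] by simp

text \<open>Padding by zeros brings two polynomials to a common degree bound, after which they are
  added coefficientwise.\<close>

lemma P2_pad:
  fixes c :: "nat \<Rightarrow> nat \<Rightarrow> complex"
  assumes "N \<le> M"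
  shows "(\<Sum>m\<le>N. \<Sum>n\<le>N. c m n * x ^ m * y ^ n)
       = (\<Sum>m\<le>M. \<Sum>n\<le>M. (if m \<le> N \<and> n \<le> N then c m n else 0) * x ^ m * y ^ n)"
proof -
  have "(\<Sum>n\<le>M. (if m \<le> N \<and> n \<le> N then c m n else 0) * x ^ m * y ^ n)
      = (if m \<le> N then \<Sum>n\<le>N. c m n * x ^ m * y ^ n else 0)" for m
    using assms by (auto intro!: sum.mono_neutral_cong_right split: if_splits)
  then have "(\<Sum>m\<le>M. \<Sum>n\<le>M. (if m \<le> N \<and> n \<le> N then c m n else 0) * x ^ m * y ^ n)
      = (\<Sum>m\<le>M. if m \<le> N then \<Sum>n\<le>N. c m n * x ^ m * y ^ n else 0)"
    by simp
  also have "\<dots> = (\<Sum>m\<le>N. \<Sum>n\<le>N. c m n * x ^ m * y ^ n)"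
    using assms by (intro sum.mono_neutral_cong_right) auto
  finally show ?thesis by simp
qed

lemma P2_add:
  assumes "p \<in> P2" "q \<in> P2"
  shows "(\<lambda>z. p z + q z) \<in> P2"
proof -
  obtain N c where p: "p = (\<lambda>z. \<Sum>m\<le>N. \<Sum>n\<le>N. c m n * of_real (Re z) ^ m * of_real (Im z) ^ n)"
    using assms(1) by (auto simp: P2_def)
  obtain M d where q: "q = (\<lambda>z. \<Sum>m\<le>M. \<Sum>n\<le>M. d m n * of_real (Re z) ^ m * of_real (Im z) ^ n)"
    using assms(2) by (auto simp: P2_def)
  define K where "K = max N M"
  define e where "e m n = (if m \<le> N \<and> n \<le> N then c m n else 0) + (if m \<le> M \<and> n \<le> M then d m n else 0)"
    for m n
  have "p z + q z = (\<Sum>m\<le>K. \<Sum>n\<le>K. e m n * of_real (Re z) ^ m * of_real (Im z) ^ n)" for z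
    unfolding p q e_def
    by (subst P2_pad[of N K], simp add: K_def, subst P2_pad[of M K], simp add: K_def)
       (simp only: distrib_right sum.distrib)
  then show ?thesis unfolding P2_def by blast
qed

lemma P2_sum: "(\<And>i. i \<in> I \<Longrightarrow> p i \<in> P2) \<Longrightarrow> (\<lambda>z. \<Sum>i\<in>I. p i z) \<in> P2"
  by (induction I rule: infinite_finite_induct) (auto intro: P2_const P2_add)

text \<open>Expanding the product leaves a sum of products of monomials, each again a monomial. This
  avoids computing the coefficients of the product.\<close>

lemma P2_mult:
  assumes "p \<in> P2" "q \<in> P2"
  shows "(\<lambda>z. p z * q z) \<in> P2"
proof -
  obtain N c where p: "p = (\<lambda>z. \<Sum>m\<le>N. \<Sum>n\<le>N. c m n * of_real (Re z) ^ m * of_real (Im z) ^ n)"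
    using assms(1) by (auto simp: P2_def)
  obtain M d where q: "q = (\<lambda>z. \<Sum>m\<le>M. \<Sum>n\<le>M. d m n * of_real (Re z) ^ m * of_real (Im z) ^ n)"
    using assms(2) by (auto simp: P2_def)
  have "(\<lambda>z. (c m n * of_real (Re z) ^ m * of_real (Im z) ^ n)
          * (d k l * of_real (Re z) ^ k * of_real (Im z) ^ l)) \<in> P2" for m n k l
    using P2_monom[of "c m n * d k l" "m + k" "n + l"] by (simp add: power_add mult_ac)
  then show ?thesis
    unfolding p q sum_distrib_left sum_distrib_right by (intro P2_sum)
qed

lemma P2_power: "p \<in> P2 \<Longrightarrow> (\<lambda>z. p z ^ n) \<in> P2"
  by (induction n) (auto intro: P2_const P2_mult)

lemma P2_inner: "(\<lambda>z. of_real (w \<bullet> z)) \<in> P2"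
proof -
  have "(\<lambda>z. of_real (Re w) * of_real (Re z) ^ 1 * of_real (Im z) ^ 0
           + of_real (Im w) * of_real (Re z) ^ 0 * of_real (Im z) ^ 1) \<in> P2"
    by (intro P2_add P2_monom)
  then show ?thesis by (simp add: inner_complex_def)
qed

section \<open>\<open>AC\<close> as a closed algebra containing the C1 functions of a linear
  coordinate\<close>

text \<open>The factor 2 is absorbed by the quantifier over \<open>e\<close>. Membership in
  \<open>BV\<close> is recovered from a single approximation: the polynomial lies in
  \<open>BV\<close> since \<open>\<sigma>\<close> is bounded, and so does its difference from
  \<open>f\<close>.\<close>

lemma AC_iff_bv_bound:
  assumes "bounded \<sigma>"
  shows "f \<in> AC \<sigma> \<longleftrightarrow> (\<forall>e>0. \<exists>p\<in>P2. bv_bound \<sigma> (\<lambda>z. f z - p z) e)"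
proof
  assume f: "f \<in> AC \<sigma>"
  show "\<forall>e>0. \<exists>p\<in>P2. bv_bound \<sigma> (\<lambda>z. f z - p z) e"
  proof (intro allI impI)
    fix e :: real assume "0 < e"
    then have "0 < ennreal e" by simp
    then obtain p where "p \<in> P2" "BV_norm \<sigma> (\<lambda>z. f z - p z) < ennreal e"
      using f unfolding AC_def by blast
    with \<open>0 < e\<close> show "\<exists>p\<in>P2. bv_bound \<sigma> (\<lambda>z. f z - p z) e"
      by (intro bexI[of _ p] bv_bound_of_BV_norm) auto
  qed
next
  assume *: "\<forall>e>0. \<exists>p\<in>P2. bv_bound \<sigma> (\<lambda>z. f z - p z) e"
  then obtain p where p: "p \<in> P2" "bv_bound \<sigma> (\<lambda>z. f z - p z) 1"
    using zero_less_one by blast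
  then have "(\<lambda>z. f z - p z) \<in> BV \<sigma>" "p \<in> BV \<sigma>"
    using P2_subset_BV[OF assms] by (auto simp: BV_iff_bv_bound)
  then have "(\<lambda>z. (f z - p z) + p z) \<in> BV \<sigma>" by (rule BV_add)
  then have "f \<in> BV \<sigma>" by simp
  moreover have "\<exists>p\<in>P2. BV_norm \<sigma> (\<lambda>z. f z - p z) < \<epsilon>" if "0 < \<epsilon>" for \<epsilon> :: ennreal
  proof -
    \<comment> \<open>\<open>\<epsilon>\<close> may be infinite; a value strictly below it is
      finite.\<close>
    obtain d where d: "0 < d" "d < \<epsilon>" using dense[OF \<open>0 < \<epsilon>\<close>] by blast
    then obtain e where e: "0 < ennreal e" "ennreal e < \<epsilon>" by (cases d) auto
    then have "0 < e / 2" by simp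
    then obtain p where "p \<in> P2" "bv_bound \<sigma> (\<lambda>z. f z - p z) (e / 2)"
      using * by blast
    then show ?thesis
      using BV_norm_le_bv_bound[of \<sigma> "\<lambda>z. f z - p z" "e / 2"] e
      by (intro bexI[of _ p]) auto
  qed
  ultimately show "f \<in> AC \<sigma>" by (simp add: AC_def)
qed

lemma P2_subset_AC:
  assumes "bounded \<sigma>"
  shows "P2 \<subseteq> AC \<sigma>"
proof
  fix p assume "p \<in> P2"
  moreover have "bv_bound \<sigma> (\<lambda>z. p z - p z) e" if "0 < e" for e
    using that by (simp add: bv_bound_def cvar_def)
  ultimately show "p \<in> AC \<sigma>"
    using AC_iff_bv_bound[OF assms] by blast
qed

lemma AC_mono:
  assumes "bounded \<sigma>" "\<tau> \<subseteq> \<sigma>"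
  shows "AC \<sigma> \<subseteq> AC \<tau>"
  using assms AC_iff_bv_bound[of \<sigma>] AC_iff_bv_bound[of \<tau>] bounded_subset[OF assms]
    bv_bound_mono[OF _ order_refl assms(2)] by blast

lemma AC_closed:
  assumes "bounded \<sigma>" and "\<And>e. 0 < e \<Longrightarrow> \<exists>g\<in>AC \<sigma>. bv_bound \<sigma> (\<lambda>z. f z - g z) e"
  shows "f \<in> AC \<sigma>"
  unfolding AC_iff_bv_bound[OF assms(1)]
proof (intro allI impI)
  fix e :: real assume "0 < e"
  then obtain g where g: "g \<in> AC \<sigma>" "bv_bound \<sigma> (\<lambda>z. f z - g z) (e / 2)"
    using assms(2)[of "e / 2"] by auto
  then obtain p where p: "p \<in> P2" "bv_bound \<sigma> (\<lambda>z. g z - p z) (e / 2)"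
    using \<open>0 < e\<close> AC_iff_bv_bound[OF assms(1)] by (meson half_gt_zero)
  show "\<exists>p\<in>P2. bv_bound \<sigma> (\<lambda>z. f z - p z) e"
    using bv_bound_add[OF g(2) p(2)] p(1) by auto
qed

lemma AC_add:
  assumes "bounded \<sigma>" "f \<in> AC \<sigma>" "g \<in> AC \<sigma>"
  shows "(\<lambda>z. f z + g z) \<in> AC \<sigma>"
  unfolding AC_iff_bv_bound[OF assms(1)]
proof (intro allI impI)
  fix e :: real assume "0 < e"
  then obtain p q where p: "p \<in> P2" "bv_bound \<sigma> (\<lambda>z. f z - p z) (e / 2)"
    and q: "q \<in> P2" "bv_bound \<sigma> (\<lambda>z. g z - q z) (e / 2)"
    using assms AC_iff_bv_bound[OF assms(1)] by (meson half_gt_zero)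
  show "\<exists>p\<in>P2. bv_bound \<sigma> (\<lambda>z. f z + g z - p z) e"
    using bv_bound_add[OF p(2) q(2)] P2_add[OF p(1) q(1)]
    by (intro bexI[of _ "\<lambda>z. p z + q z"]) (simp_all add: algebra_simps)
qed

lemma AC_mult_P2:
  assumes "bounded \<sigma>" "f \<in> AC \<sigma>" "q \<in> P2"
  shows "(\<lambda>z. f z * q z) \<in> AC \<sigma>"
  unfolding AC_iff_bv_bound[OF assms(1)]
proof (intro allI impI)
  fix e :: real assume "0 < e"
  obtain b where b: "bv_bound \<sigma> q b"
    using P2_subset_BV[OF assms(1)] assms(3) BV_iff_bv_bound by blast
  note b0 = bv_bound_nonneg[OF b]
  \<comment> \<open>The denominator absorbs the constant from \<open>bv_bound_mult\<close>; the
    added 1 keeps it positive when \<open>b = 0\<close>.\<close>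
  define d where "d = e / (2 * (b + 1))"
  have d: "0 < d" using \<open>0 < e\<close> b0 by (simp add: d_def)
  then obtain p where p: "p \<in> P2" "bv_bound \<sigma> (\<lambda>z. f z - p z) d"
    using assms AC_iff_bv_bound[OF assms(1)] by blast
  have "2 * d * b \<le> 2 * d * (b + 1)" using d by simp
  also have "\<dots> = e" using b0 by (simp add: d_def field_simps)
  finally have "2 * d * b \<le> e" .
  with bv_bound_mult[OF p(2) b] have "bv_bound \<sigma> (\<lambda>z. (f z - p z) * q z) e"
    by (rule bv_bound_mono) simp
  then show "\<exists>p\<in>P2. bv_bound \<sigma> (\<lambda>z. f z * q z - p z) e"
    using P2_mult[OF p(1) assms(3)] by (intro bexI[of _ "\<lambda>z. p z * q z"]) (simp_all add: algebra_simps)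
qed

text \<open>The factors are approximated one at a time, so that the bound of the other factor stays
  fixed: \<open>g\<close> by polynomials here, and \<open>f\<close> in
  \<open>AC_mult_P2\<close>.\<close>

lemma AC_mult:
  assumes "bounded \<sigma>" "f \<in> AC \<sigma>" "g \<in> AC \<sigma>"
  shows "(\<lambda>z. f z * g z) \<in> AC \<sigma>"
proof (rule AC_closed[OF assms(1)])
  fix e :: real assume "0 < e"
  obtain b where b: "bv_bound \<sigma> f b"
    using assms(2) BV_iff_bv_bound by (auto simp: AC_def)
  note b0 = bv_bound_nonneg[OF b]
  define d where "d = e / (2 * (b + 1))"
  have d: "0 < d" using \<open>0 < e\<close> b0 by (simp add: d_def)
  then obtain q where q: "q \<in> P2" "bv_bound \<sigma> (\<lambda>z. g z - q z) d"
    using assms AC_iff_bv_bound[OF assms(1)] by blast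
  have "2 * b * d \<le> 2 * (b + 1) * d" using d by simp
  also have "\<dots> = e" using b0 by (simp add: d_def field_simps)
  finally have "2 * b * d \<le> e" .
  with bv_bound_mult[OF b q(2)] have "bv_bound \<sigma> (\<lambda>z. f z * (g z - q z)) e"
    by (rule bv_bound_mono) simp
  then show "\<exists>h\<in>AC \<sigma>. bv_bound \<sigma> (\<lambda>z. f z * g z - h z) e"
    using AC_mult_P2[OF assms(1,2) q(1)] by (intro bexI[of _ "\<lambda>z. f z * q z"]) (simp_all add: algebra_simps)
qed

lemma AC_const: "bounded \<sigma> \<Longrightarrow> (\<lambda>z. c) \<in> AC \<sigma>"
  using P2_subset_AC P2_const by blast

lemma AC_diff:
  assumes "bounded \<sigma>" "f \<in> AC \<sigma>" "g \<in> AC \<sigma>"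
  shows "(\<lambda>z. f z - g z) \<in> AC \<sigma>"
  using AC_add[OF assms(1,2) AC_mult[OF assms(1) AC_const[OF assms(1), of "-1"] assms(3)]] by simp

lemma AC_prod:
  assumes "bounded \<sigma>" "\<And>i. i \<in> I \<Longrightarrow> f i \<in> AC \<sigma>"
  shows "(\<lambda>z. \<Prod>i\<in>I. f i z) \<in> AC \<sigma>"
  using assms(2)
  by (induction I rule: infinite_finite_induct) (auto intro: AC_const AC_mult assms(1))

text \<open>
  Approximating the derivative uniformly by a polynomial and integrating makes the error Lipschitz
  with a small constant, hence small in variation.
\<close>

lemma AC_C1_inner:
  fixes h h' :: "real \<Rightarrow> real"
  assumes "bounded \<sigma>" and h: "\<And>t. (h has_real_derivative h' t) (at t)"
    and cont: "continuous_on UNIV h'"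
  shows "(\<lambda>z. of_real (h (w \<bullet> z))) \<in> AC \<sigma>"
  unfolding AC_iff_bv_bound[OF assms(1)]
proof (intro allI impI)
  fix e :: real assume "0 < e"
  obtain a b where ab: "a \<le> b" "\<And>z. z \<in> \<sigma> \<Longrightarrow> w \<bullet> z \<in> {a..b}"
    using bounded_inner_interval[OF assms(1)] by metis
  define d where "d = e / (b - a + 1)"
  have d: "0 < d" using \<open>0 < e\<close> ab(1) by (simp add: d_def)
  have "continuous_on {a..b} h'" using cont by (rule continuous_on_subset) simp
  then obtain g where g: "real_polynomial_function g" "\<And>t. t \<in> {a..b} \<Longrightarrow> \<bar>h' t - g t\<bar> < d"
    using Stone_Weierstrass_real_polynomial_function[of "{a..b}" h' d] d by auto
  then obtain c n where c: "g = (\<lambda>t. \<Sum>i\<le>n. c i * t ^ i)"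
    using real_polynomial_function_imp_sum[OF g(1)] by blast
  define G where "G t = (\<Sum>i\<le>n. c i / real (Suc i) * t ^ Suc i)" for t
  \<comment> \<open>The additive constant makes \<open>k a = 0\<close>, so that the bound reduces to
    \<open>d * (b - a)\<close>, which is at most \<open>e\<close>. The 1 in the denominator of
    \<open>d\<close> covers \<open>a = b\<close>.\<close>
  define k where "k t = h t - (G t + (h a - G a))" for t
  have G: "(G has_real_derivative g t) (at t)" for t
    unfolding G_def c
    by (rule derivative_eq_intros refl | simp add: mult.commute)+
  have k': "(k has_real_derivative h' t - g t) (at t)" for t
    unfolding k_def by (auto intro!: derivative_eq_intros h G)
  have "\<bar>k t - k s\<bar> \<le> d * \<bar>t - s\<bar>" if "s \<in> {a..b}" "t \<in> {a..b}" for s t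
    using field_differentiable_bound[of "{a..b}" k "\<lambda>t. h' t - g t" d t s] that g(2) k'
    by (auto simp: less_imp_le has_field_derivative_at_within)
  then have "bv_bound \<sigma> (\<lambda>z. of_real (k (w \<bullet> z))) (\<bar>k a\<bar> + d * (b - a))"
    using ab d by (intro bv_bound_Lipschitz_inner) auto
  moreover have "\<bar>k a\<bar> + d * (b - a) \<le> e"
    using ab(1) \<open>0 < e\<close> by (simp add: k_def d_def field_simps)
  ultimately have "bv_bound \<sigma> (\<lambda>z. of_real (k (w \<bullet> z))) e"
    by (rule bv_bound_mono) simp
  moreover have "(\<lambda>z. of_real (G (w \<bullet> z) + (h a - G a))) \<in> P2"
    unfolding G_def of_real_add of_real_sum of_real_mult of_real_power
    by (intro P2_add P2_sum P2_mult P2_power P2_inner P2_const)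
  ultimately show "\<exists>p\<in>P2. bv_bound \<sigma> (\<lambda>z. of_real (h (w \<bullet> z)) - p z) e"
    by (intro bexI) (simp_all add: k_def)
qed

section \<open>Cutoff functions of squares\<close>

text \<open>A truncated square is continuously differentiable across 0, which is the regularity that
  \<open>AC_C1_inner\<close> asks for.\<close>

definition sq_pos :: "real \<Rightarrow> real" where
  "sq_pos t = (max 0 t)\<^sup>2"

lemma sq_pos_has_derivative: "(sq_pos has_real_derivative 2 * max 0 t) (at t)"
proof -
  consider "t < 0" | "t = 0" | "0 < t" by linarith
  then show ?thesis
  proof cases
    case 1
    have "((\<lambda>_. 0) has_real_derivative 0) (at t)" by simp
    then have "(sq_pos has_real_derivative 0) (at t)"
      by (rule has_field_derivative_transform_within_open[where S = "{..<0}"])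
         (use 1 in \<open>auto simp: sq_pos_def\<close>)
    then show ?thesis using 1 by simp
  next
    case 2
    have "((\<lambda>h. max 0 h) \<longlongrightarrow> max 0 (0::real)) (at 0)"
      by (intro tendsto_intros)
    moreover have "\<forall>\<^sub>F h in at 0. max 0 h = (sq_pos (t + h) - sq_pos t) / h"
      by (auto simp: eventually_at_filter sq_pos_def 2 max_def power2_eq_square)
    ultimately have "((\<lambda>h. (sq_pos (t + h) - sq_pos t) / h) \<longlongrightarrow> 0) (at 0)"
      using tendsto_cong by force
    then show ?thesis by (simp add: DERIV_def 2)
  next
    case 3
    have "((\<lambda>s. s\<^sup>2) has_real_derivative 2 * t) (at t)"
      by (auto intro!: derivative_eq_intros)
    then have "(sq_pos has_real_derivative 2 * t) (at t)"
      by (rule has_field_derivative_transform_within_open[where S = "{0<..}"])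
         (use 3 in \<open>auto simp: sq_pos_def\<close>)
    then show ?thesis using 3 by simp
  qed
qed

text \<open>The second antiderivative of a step function of mean zero, normalised to rise from 0 to 1.\<close>

definition smooth_step :: "real \<Rightarrow> real" where
  "smooth_step t = 2 * sq_pos t - 4 * sq_pos (t - 1 / 2) + 2 * sq_pos (t - 1)"

lemma smooth_step_0: "t \<le> 0 \<Longrightarrow> smooth_step t = 0"
  by (simp add: smooth_step_def sq_pos_def)

text \<open>Here all three squares are active, and their quadratic and linear terms cancel.\<close>

lemma smooth_step_1: "1 \<le> t \<Longrightarrow> smooth_step t = 1"
  by (simp add: smooth_step_def sq_pos_def max_def power2_eq_square algebra_simps)

lemma AC_smooth_step:
  assumes "bounded \<sigma>"
  shows "(\<lambda>z. of_real (smooth_step (a * (w \<bullet> z) + b))) \<in> AC \<sigma>"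
proof -
  note sq_pos_deriv = DERIV_chain2[OF sq_pos_has_derivative]
  have "((\<lambda>t. smooth_step (a * t + b)) has_real_derivative
      a * (4 * max 0 (a * t + b) - 8 * max 0 (a * t + b - 1 / 2) + 4 * max 0 (a * t + b - 1))) (at t)" for t
    unfolding smooth_step_def
    by (rule derivative_eq_intros sq_pos_deriv refl | simp add: algebra_simps)+
  moreover have "continuous_on UNIV
      (\<lambda>t. a * (4 * max 0 (a * t + b) - 8 * max 0 (a * t + b - 1 / 2) + 4 * max 0 (a * t + b - 1)))"
    by (intro continuous_intros)
  ultimately show ?thesis
    by (rule AC_C1_inner[OF assms])
qed

text \<open>The vectors \<open>w\<close> are the outer normals of a square of half-side
  \<open>r\<close>. Each factor depends on one linear coordinate; for \<open>r > 0\<close> it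
  vanishes from its side outwards, and by the scale \<open>2 / r\<close> it is 1 where
  \<open>w \<bullet> (z - x) \<le> r / 2\<close>.\<close>

definition cutoff :: "complex \<Rightarrow> real \<Rightarrow> complex \<Rightarrow> complex" where
  "cutoff x r z = (\<Prod>w\<in>{1, -1, \<i>, -\<i>}. of_real (smooth_step ((r - w \<bullet> (z - x)) * (2 / r))))"

lemma AC_cutoff:
  assumes "bounded \<sigma>"
  shows "cutoff x r \<in> AC \<sigma>"
proof -
  have "(\<lambda>z. of_real (smooth_step ((r - w \<bullet> (z - x)) * (2 / r)))) \<in> AC \<sigma>" for w
  proof -
    have "(r - w \<bullet> (z - x)) * (2 / r) = - (2 / r) * (w \<bullet> z) + (r + w \<bullet> x) * (2 / r)" for z
      by (simp add: inner_diff_right algebra_simps)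
    then show ?thesis using AC_smooth_step[OF assms, of "- (2 / r)" w] by presburger
  qed
  then show ?thesis
    unfolding cutoff_def[abs_def] by (intro AC_prod assms)
qed

definition square :: "complex \<Rightarrow> real \<Rightarrow> complex set" where
  "square x r = {z. \<bar>Re z - Re x\<bar> \<le> r \<and> \<bar>Im z - Im x\<bar> \<le> r}"

definition open_square :: "complex \<Rightarrow> real \<Rightarrow> complex set" where
  "open_square x r = {z. \<bar>Re z - Re x\<bar> < r \<and> \<bar>Im z - Im x\<bar> < r}"

lemma cutoff_0:
  assumes "0 < r" "z \<notin> open_square x r"
  shows "cutoff x r z = 0"
proof -
  have "\<exists>w\<in>{1, -1, \<i>, -\<i>}. r \<le> w \<bullet> (z - x)"
    using assms(2) by (auto simp: open_square_def inner_complex_def abs_if split: if_splits)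
  then obtain w where w: "w \<in> {1, -1, \<i>, -\<i>}" "r \<le> w \<bullet> (z - x)" by blast
  then have "smooth_step ((r - w \<bullet> (z - x)) * (2 / r)) = 0"
    using assms(1) by (intro smooth_step_0 mult_nonpos_nonneg) auto
  then show ?thesis
    unfolding cutoff_def using w(1) by (intro prod_zero) force+
qed

text \<open>The disc lies in the concentric square of half-side \<open>r / 2\<close>, where every
  factor is 1. Such discs form the open cover in the compactness argument.\<close>

lemma cutoff_1:
  assumes "0 < r" "z \<in> ball x (r / 2)"
  shows "cutoff x r z = 1"
  unfolding cutoff_def
proof (rule prod.neutral, rule ballI)
  fix w :: complex assume "w \<in> {1, -1, \<i>, -\<i>}"
  then have "cmod w = 1" by auto
  then have "w \<bullet> (z - x) \<le> r / 2"
    using Cauchy_Schwarz_ineq2[of w "z - x"] assms(2) by (simp add: dist_norm norm_minus_commute)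
  then have "1 \<le> (r - w \<bullet> (z - x)) * (2 / r)"
    using assms(1) by (simp add: field_simps)
  then show "complex_of_real (smooth_step ((r - w \<bullet> (z - x)) * (2 / r))) = 1"
    by (simp add: smooth_step_1)
qed

section \<open>Extension by zero from a square\<close>

text \<open>
  A segment from the open square to a point outside the closed square crosses the line through one
  of the four sides; such segments are the only ones lost when the points outside are deleted.
\<close>

lemma bv_bound_extend_zero:
  assumes bv: "bv_bound (\<sigma> \<inter> square x r) g e" and zero: "\<And>z. z \<in> \<sigma> - open_square x r \<Longrightarrow> g z = 0"
  shows "bv_bound \<sigma> g (5 * e)"
proof -
  note e = bv_bound_nonneg[OF bv]
  define W where "W = {1, -1, \<i>, -\<i>}"
  define l where "l w = {z. w \<bullet> z = w \<bullet> x + r}" for w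
  \<comment> \<open>The number of side lines strictly separating \<open>y\<close> from
    \<open>z\<close>; its symmetry treats segments leaving and entering the square alike.\<close>
  define D where "D y z = (\<Sum>w\<in>W. of_bool (opposite_sides (l w) y z) :: real)" for y z
  have W: "finite W" "card W = 4" "0 \<notin> W"
    by (auto simp: W_def complex_eq_iff card_insert_if)
  have norm: "cmod (g z) \<le> e" if "z \<in> \<sigma>" for z
    using that bv_bound_norm[OF bv, of z] zero[of z] e
    by (cases "z \<in> open_square x r") (auto simp: square_def open_square_def)
  have D_nonneg: "0 \<le> D y z" for y z
    by (simp add: D_def sum_nonneg)
  have D_sym: "D y z = D z y" for y z
    by (simp add: D_def opposite_sides_sym)
  have jump: "cmod (g y - g z) \<le> e * D y z" if "y \<in> \<sigma>" "z \<in> \<sigma>" "z \<notin> square x r" for y z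
  proof -
    have gz: "g z = 0" using that zero[of z] by (auto simp: square_def open_square_def)
    show ?thesis
    proof (cases "y \<in> open_square x r")
      case False
      then show ?thesis using gz zero[of y] that e D_nonneg by simp
    next
      case True
      then have "\<exists>w\<in>W. w \<bullet> y < w \<bullet> x + r \<and> w \<bullet> x + r < w \<bullet> z"
        using that(3) by (auto simp: W_def square_def open_square_def inner_complex_def abs_if split: if_splits)
      then obtain w where w: "w \<in> W" "w \<bullet> y < w \<bullet> x + r" "w \<bullet> x + r < w \<bullet> z" by blast
      then have "opposite_sides (l w) y z"
        unfolding l_def using W(3) by (intro opposite_sidesI) auto
      then have "1 \<le> D y z"
        unfolding D_def using w(1) W(1) member_le_sum[of w W "\<lambda>w. of_bool (opposite_sides (l w) y z) :: real"]
        by simp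
      then have "e * 1 \<le> e * D y z" using e by (rule mult_left_mono)
      then show ?thesis using norm[OF that(1)] gz by simp
    qed
  qed
  let ?c = "\<lambda>y z. cmod (g z - g y)" and ?Q = "\<lambda>z. z \<in> square x r"
  \<comment> \<open>A segment with both ends in the square survives the filter. Any other increment
    is paid for by \<open>D\<close>, and new segments joining surviving points only enlarge the
    right-hand side.\<close>
  have split: "path_sum ?c S \<le> path_sum ?c (filter ?Q S) + e * path_sum D S" if "set S \<subseteq> \<sigma>" for S
    using that
  proof (induction S rule: induct_list012)
    case (3 y z S)
    have IH: "path_sum ?c (z # S) \<le> path_sum ?c (filter ?Q (z # S)) + e * path_sum D (z # S)"
      using 3 by simp
    have "?c y z \<le> e * D y z" if "\<not> (?Q y \<and> ?Q z)"
      using that jump[of y z] jump[of z y] 3(3) D_sym[of y z] by (auto simp: norm_minus_commute)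
    moreover have "path_sum ?c (filter ?Q (z # S)) \<le> path_sum ?c (filter ?Q (y # z # S))"
      using path_sum_Cons_ge[of ?c] by simp
    moreover have "path_sum ?c (filter ?Q (y # z # S)) = ?c y z + path_sum ?c (filter ?Q (z # S))"
      if "?Q y \<and> ?Q z"
      using that by simp
    moreover have "0 \<le> e * D y z" using e D_nonneg by simp
    ultimately have "?c y z + path_sum ?c (filter ?Q (z # S)) \<le> path_sum ?c (filter ?Q (y # z # S)) + e * D y z"
      by (smt (verit))
    then show ?case using IH by (simp add: distrib_left)
  qed simp_all
  \<comment> \<open>The constant 5 is 1 for the filtered list plus 1 for each of the four
    lines.\<close>
  have "cvar g S \<le> 5 * e * real (vf S)" if S: "set S \<subseteq> \<sigma>" for S
  proof -
    have "path_sum ?c (filter ?Q S) \<le> e * real (vf S)"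
    proof (cases "filter ?Q S = []")
      case True
      then show ?thesis using e by simp
    next
      case False
      have "path_sum ?c (filter ?Q S) \<le> e * real (vf (filter ?Q S))"
        using bv_bound_cvar[OF bv, of "filter ?Q S"] S by (auto simp: cvar_eq_path_sum)
      also have "\<dots> \<le> e * real (vf S)"
        using vf_filter_le[OF False] e by (intro mult_left_mono) auto
      finally show ?thesis .
    qed
    moreover have "path_sum D S \<le> 4 * real (vf S)"
    proof -
      have "path_sum D S = (\<Sum>w\<in>W. path_sum (\<lambda>y z. of_bool (opposite_sides (l w) y z)) S)"
        unfolding path_sum_eq_sum D_def by (rule sum.swap)
      also have "\<dots> \<le> (\<Sum>w\<in>W. real (vf S))"
      proof (rule sum_mono)
        fix w assume "w \<in> W"
        then have "w \<noteq> 0" using W(3) by blast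
        then show "path_sum (\<lambda>y z. of_bool (opposite_sides (l w) y z)) S \<le> real (vf S)"
          unfolding l_def by (intro opposite_sides_path_sum_le_vf plane_lineI)
      qed
      finally show ?thesis using W by simp
    qed
    then have "e * path_sum D S \<le> e * (4 * real (vf S))" using e by (rule mult_left_mono)
    ultimately show ?thesis
      using split[OF S] by (simp add: cvar_eq_path_sum)
  qed
  then show ?thesis
    using e norm by (force simp: bv_bound_def)
qed

text \<open>For a polynomial \<open>p\<close> close to \<open>f\<close> on the square,
  \<open>p\<close> times the cutoff lies in \<open>AC \<sigma>\<close>. The remainder
  \<open>(f - p)\<close> times the cutoff is small on the square and vanishes outside the open
  square, so it is small on all of \<open>\<sigma>\<close>.\<close>

lemma AC_mult_cutoff:
  assumes "bounded \<sigma>" "0 < r" "f \<in> AC (\<sigma> \<inter> square x r)"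
  shows "(\<lambda>z. f z * cutoff x r z) \<in> AC \<sigma>"
proof (rule AC_closed[OF assms(1)])
  fix e :: real assume "0 < e"
  let ?U = "\<sigma> \<inter> square x r"
  have U: "bounded ?U" using assms(1) by (simp add: bounded_Int)
  obtain b where b: "bv_bound ?U (cutoff x r) b"
    using AC_cutoff[OF U, of x r] BV_iff_bv_bound by (auto simp: AC_def)
  note b0 = bv_bound_nonneg[OF b]
  \<comment> \<open>The factor 10 combines 2 from the product estimate and 5 from the extension by
    zero.\<close>
  define d where "d = e / (10 * (b + 1))"
  have d: "0 < d" using \<open>0 < e\<close> b0 by (simp add: d_def)
  then obtain p where p: "p \<in> P2" "bv_bound ?U (\<lambda>z. f z - p z) d"
    using assms(3) AC_iff_bv_bound[OF U] by blast
  have "10 * d * b \<le> 10 * d * (b + 1)" using d by simp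
  also have "\<dots> = e" using b0 by (simp add: d_def field_simps)
  finally have le: "5 * (2 * d * b) \<le> e" by simp
  have "bv_bound \<sigma> (\<lambda>z. (f z - p z) * cutoff x r z) (5 * (2 * d * b))"
    using bv_bound_mult[OF p(2) b] by (rule bv_bound_extend_zero) (simp add: cutoff_0 assms(2))
  then have "bv_bound \<sigma> (\<lambda>z. (f z - p z) * cutoff x r z) e"
    using le by (rule_tac bv_bound_mono) auto
  moreover have "(\<lambda>z. p z * cutoff x r z) \<in> AC \<sigma>"
    using P2_subset_AC[OF assms(1)] p(1) AC_cutoff AC_mult assms(1) by blast
  ultimately show "\<exists>g\<in>AC \<sigma>. bv_bound \<sigma> (\<lambda>z. f z * cutoff x r z - g z) e"
    by (intro bexI[of _ "\<lambda>z. p z * cutoff x r z"]) (simp_all add: algebra_simps)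
qed

section \<open>From local to global by compactness\<close>

lemma compact_neighbourhood_square:
  assumes "compact_neighbourhood \<sigma> x U"
  obtains r where "0 < r" "\<sigma> \<inter> square x r \<subseteq> U"
proof -
  obtain V where V: "open V" "x \<in> V" "U = \<sigma> \<inter> closure V"
    using assms by (auto simp: compact_neighbourhood_def)
  then obtain d where d: "0 < d" "ball x d \<subseteq> V" by (meson openE)
  \<comment> \<open>The modulus is at most the sum of the two coordinate distances, here at most
    \<open>2 * d / 3\<close>.\<close>
  have "square x (d / 3) \<subseteq> ball x d"
  proof
    fix z assume "z \<in> square x (d / 3)"
    then show "z \<in> ball x d"
      using cmod_le[of "z - x"] d(1) by (auto simp: square_def dist_norm norm_minus_commute)
  qed
  then show ?thesis
    using that[of "d / 3"] d V(3) closure_subset[of V] by auto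
qed

theorem theorem4p1:
  fixes \<sigma> :: "complex set" and f :: "complex \<Rightarrow> complex"
  assumes "compact \<sigma>" and "\<sigma> \<noteq> {}"
  shows "f \<in> AC \<sigma> \<longleftrightarrow> (\<forall>x\<in>\<sigma>. \<exists>U. compact_neighbourhood \<sigma> x U \<and> f \<in> AC U)"
proof
  assume "f \<in> AC \<sigma>"
  moreover have "compact_neighbourhood \<sigma> x \<sigma>" for x
    unfolding compact_neighbourhood_def by (intro exI[of _ UNIV]) auto
  ultimately show "\<forall>x\<in>\<sigma>. \<exists>U. compact_neighbourhood \<sigma> x U \<and> f \<in> AC U" by blast
next
  assume local: "\<forall>x\<in>\<sigma>. \<exists>U. compact_neighbourhood \<sigma> x U \<and> f \<in> AC U"
  have bdd: "bounded \<sigma>" using assms(1) by (rule compact_imp_bounded)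
  have "\<exists>r>0. f \<in> AC (\<sigma> \<inter> square x r)" if x: "x \<in> \<sigma>" for x
  proof -
    obtain U where U: "compact_neighbourhood \<sigma> x U" "f \<in> AC U" using local x by blast
    moreover obtain r where "0 < r" "\<sigma> \<inter> square x r \<subseteq> U"
      using compact_neighbourhood_square[OF U(1)] .
    moreover have "bounded U"
      using U(1) bdd by (auto simp: compact_neighbourhood_def bounded_Int)
    ultimately show ?thesis using AC_mono by blast
  qed
  then obtain r where r: "\<And>x. x \<in> \<sigma> \<Longrightarrow> 0 < r x" "\<And>x. x \<in> \<sigma> \<Longrightarrow> f \<in> AC (\<sigma> \<inter> square x (r x))"
    by metis
  define \<psi> where "\<psi> x = cutoff x (r x)" for x
  have "\<sigma> \<subseteq> (\<Union>x\<in>\<sigma>. ball x (r x / 2))" using r(1) by fastforce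
  then obtain C where C: "C \<subseteq> \<sigma>" "finite C" "\<sigma> \<subseteq> (\<Union>x\<in>C. ball x (r x / 2))"
    using compactE_image[OF assms(1), of \<sigma> "\<lambda>x. ball x (r x / 2)"] by auto
  \<comment> \<open>The sum of the pieces of the partition of unity telescopes to 1 minus the
    product. Inserting \<open>x\<close> adds the piece \<open>\<psi> x\<close> times the old
    product.\<close>
  have "(\<lambda>z. f z * (1 - (\<Prod>x\<in>C. 1 - \<psi> x z))) \<in> AC \<sigma>"
    using C(2,1)
  proof (induction C rule: finite_induct)
    case empty
    show ?case using AC_const[OF bdd, of 0] by simp
  next
    case (insert x C)
    have "(\<lambda>z. f z * \<psi> x z) \<in> AC \<sigma>"
      unfolding \<psi>_def using insert.prems r bdd by (intro AC_mult_cutoff) auto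
    moreover have "(\<lambda>z. \<Prod>x\<in>C. 1 - \<psi> x z) \<in> AC \<sigma>"
      unfolding \<psi>_def by (intro AC_prod AC_diff AC_const AC_cutoff bdd)
    \<comment> \<open>\<open>f\<close> is grouped with \<open>\<psi> x\<close>, because that product
      is already known to lie in \<open>AC \<sigma>\<close>, while \<open>f\<close> itself is
      not.\<close>
    ultimately have "(\<lambda>z. f z * (1 - (\<Prod>x\<in>C. 1 - \<psi> x z)) + f z * \<psi> x z * (\<Prod>x\<in>C. 1 - \<psi> x z)) \<in> AC \<sigma>"
      using insert by (intro AC_add[OF bdd] AC_mult[OF bdd, of "\<lambda>z. f z * \<psi> x z"]) auto
    then show ?case
      using insert.hyps by (simp add: algebra_simps)
  qed
  \<comment> \<open>Every point of \<open>\<sigma>\<close> lies in a disc of the finite cover, where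
    one factor vanishes. The patched function therefore agrees with \<open>f\<close> on
    \<open>\<sigma>\<close>.\<close>
  moreover have "(\<Prod>x\<in>C. 1 - \<psi> x z) = 0" if "z \<in> \<sigma>" for z
  proof -
    obtain x where "x \<in> C" "z \<in> ball x (r x / 2)" using C(3) \<open>z \<in> \<sigma>\<close> by blast
    then have "\<psi> x z = 1" unfolding \<psi>_def using r(1) C(1) by (intro cutoff_1) auto
    then show ?thesis using \<open>x \<in> C\<close> C(2) by (intro prod_zero) auto
  qed
  ultimately show "f \<in> AC \<sigma>"
    using AC_cong[of \<sigma> f "\<lambda>z. f z * (1 - (\<Prod>x\<in>C. 1 - \<psi> x z))"] by simp
qed

end
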